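(* The set $\mathcal{LP}_4$ is decomposed into the following two disjoint subsets. (i) The subset $\mathcal{LP}_{4,1}\sqcup\mathcal{LP}_{4,2}$, which is formed by the $144$ polynomials with separate variables of the form $$s_{20}x^2+s_{02}y^2+s_{10}x+s_{01}y+s_{00}\in\mathbb{F}_4[x,y],\quad\text{where } s_{01}^3+s_{02}^3=s_{10}^3+s_{20}^3=1.$$ (ii) The subset $\mathcal{LP}_{4,4}$, which is formed by the $432$ polynomials of the form $$(s_{22}xy+s_{21}x+s_{12}y+s_{12}s_{21}s_{22}^2)xy+s_{20}x^2+s_{02}y^2+(s_{20}s_{22}+s_{21}^2)s_{12}s_{22}x+(s_{02}s_{22}+s_{12}^2)s_{21}s_{22}y+s_{00}\in\mathbb{F}_4[x,y],$$ where $$s_{22}^3=s_{21}^3=s_{12}^3=1,\qquad s_{20}(s_{20}s_{22}+s_{21}^2)=0,\qquad s_{02}(s_{02}s_{22}+s_{12}^2)=0.$$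
   Context: $\mathbb{F}_4$ is the field with four elements; all coefficients $s_{ij}$ lie in $\mathbb{F}_4$. $\mathcal{LP}_4$ is the set of local permutation polynomials over $\mathbb{F}_4$: polynomials $f\in\mathbb{F}_4[x,y]$ of degree less than $4$ in each variable such that, for every $a\in\mathbb{F}_4$, both $f(x,a)$ and $f(a,x)$ act as permutations of $\mathbb{F}_4$. $\mathcal{LP}_{4,d}$ is the subset of polynomials of total degree $d$ in $\mathcal{LP}_4$. A polynomial in $\mathcal{LP}_4$ has separate variables if it is of the form $h_1(x)+h_2(y)$ with $h_1,h_2$ polynomials of degree less than $4$ that act as permutations of $\mathbb{F}_4$. *)

theory Defs
  imports "HOL-Computational_Algebra.Polynomial" "HOL-Library.Cardinality"
begin

text \<open>
  The ring F[x,y] is rendered as \<open>'a poly poly\<close>: the outer variable is y and the inner one is x, so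
  \<open>coeff (coeff f j) i\<close> is the coefficient of x^i y^j in \<open>f\<close>.
\<close>

definition X :: "'a::comm_ring_1 poly poly" where
  "X = [:[:0, 1:]:]"

definition Y :: "'a::comm_ring_1 poly poly" where
  "Y = [:0, 1:]"

definition Const :: "'a::comm_ring_1 \<Rightarrow> 'a poly poly" where
  "Const c = [:[:c:]:]"

definition degree_x :: "'a::comm_ring_1 poly poly \<Rightarrow> nat" where
  "degree_x f = Max ((\<lambda>j. degree (coeff f j)) ` {..degree f})"

definition degree_y :: "'a::comm_ring_1 poly poly \<Rightarrow> nat" where
  "degree_y f = degree f"

text \<open>As for \<^const>\<open>degree\<close>, the zero polynomial is given total degree 0.\<close>

definition total_degree :: "'a::comm_ring_1 poly poly \<Rightarrow> nat" where
  "total_degree f = (if f = 0 then 0 else Max {i + j | i j. coeff (coeff f j) i \<noteq> 0})"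

text \<open>\<open>subst_y f a\<close> is f(x,a) and \<open>subst_x f a\<close> is f(a,y), as univariate polynomials.\<close>

definition subst_y :: "'a::comm_ring_1 poly poly \<Rightarrow> 'a \<Rightarrow> 'a poly" where
  "subst_y f a = poly f [:a:]"

definition subst_x :: "'a::comm_ring_1 poly poly \<Rightarrow> 'a \<Rightarrow> 'a poly" where
  "subst_x f a = map_poly (\<lambda>p. poly p a) f"

definition permutation_poly :: "'a::comm_ring_1 poly \<Rightarrow> bool" where
  "permutation_poly p \<longleftrightarrow> bij (poly p)"

definition local_perm_polys :: "'a::{field, finite} poly poly set" where
  "local_perm_polys =
     {f. degree_x f < CARD('a) \<and> degree_y f < CARD('a) \<and>
         (\<forall>a. permutation_poly (subst_y f a) \<and> permutation_poly (subst_x f a))}"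

definition local_perm_polys_deg :: "nat \<Rightarrow> 'a::{field, finite} poly poly set" where
  "local_perm_polys_deg d = {f \<in> local_perm_polys. total_degree f = d}"

text \<open>In F[x,y], \<open>[:h\<^sub>1:]\<close> is h1(x) and \<open>map_poly (\<lambda>c. [:c:]) h\<^sub>2\<close> is h2(y).\<close>

definition separate_variables :: "'a::{field, finite} poly poly \<Rightarrow> bool" where
  "separate_variables f \<longleftrightarrow>
     (\<exists>h\<^sub>1 h\<^sub>2 :: 'a poly. degree h\<^sub>1 < CARD('a) \<and> degree h\<^sub>2 < CARD('a) \<and>
        permutation_poly h\<^sub>1 \<and> permutation_poly h\<^sub>2 \<and>
        f = [:h\<^sub>1:] + map_poly (\<lambda>c. [:c:]) h\<^sub>2)"

end

theory Submission imports Defs begin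

text \<open>
  Over \<open>F\<^sub>4\<close> a polynomial of degree at most 3 permutes the field iff it has the form
  \<open>a + b x + c x^2\<close> with exactly one of \<open>b\<close>, \<open>c\<close> nonzero. So a local permutation polynomial
  has degree at most 2 in each variable, and writing \<open>f = A(y) x^2 + B(y) x + C(y)\<close> it satisfies
  \<open>A(y) B(y) = 0\<close> for all \<open>y\<close> with \<open>A\<close> and \<open>B\<close> never vanishing together; likewise
  with \<open>x\<close> and \<open>y\<close> exchanged. Reducing \<open>A B\<close> modulo \<open>y^4 - y\<close> turns this into equations between
  the coefficients, whose solutions split according to whether the coefficient of \<open>x^2 y^2\<close>
  vanishes.
\<close>

section \<open>Polynomials of degree at most 2 in each variable, and the two families\<close>

definition biquadratic ::
  "'a \<Rightarrow> 'a \<Rightarrow> 'a \<Rightarrow> 'a \<Rightarrow> 'a \<Rightarrow> 'a \<Rightarrow> 'a \<Rightarrow> 'a \<Rightarrow> 'a \<Rightarrow> 'a::comm_ring_1 poly poly" where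
  "biquadratic s22 s21 s12 s11 s20 s02 s10 s01 s00 =
     [:[:s00, s10, s20:], [:s01, s11, s21:], [:s02, s12, s22:]:]"

lemma coeff_pCons4 [simp]:
  "coeff [:a, b, c, d:] 0 = a" "coeff [:a, b, c, d:] (Suc 0) = b"
  "coeff [:a, b, c, d:] 2 = c" "coeff [:a, b, c, d:] 3 = d"
  by (simp_all add: numeral_eq_Suc)

lemma coeff_pCons3 [simp]:
  "coeff [:a, b, c:] 2 = c" "coeff [:a, b, c:] 3 = 0"
  by (simp_all add: numeral_eq_Suc)

lemma poly_eq_pCons3I:
  assumes "\<And>i. 3 \<le> i \<Longrightarrow> coeff p i = 0"
  shows "p = [:coeff p 0, coeff p 1, coeff p 2:]"
proof (rule poly_eqI)
  fix i :: nat
  consider "i = 0" | "i = 1" | "i = 2" | "3 \<le> i" by linarith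
  then show "coeff p i = coeff [:coeff p 0, coeff p 1, coeff p 2:] i"
    by cases (auto simp: assms coeff_eq_0)
qed

lemma poly_eq_pCons4I:
  assumes "degree p < 4"
  shows "p = [:coeff p 0, coeff p 1, coeff p 2, coeff p 3:]"
proof (rule poly_eqI)
  fix i :: nat
  consider "i = 0" | "i = 1" | "i = 2" | "i = 3" | "4 \<le> i" by linarith
  then show "coeff p i = coeff [:coeff p 0, coeff p 1, coeff p 2, coeff p 3:] i"
    using assms by cases (auto simp: coeff_eq_0)
qed

lemma biquadratic_eq_iff:
  "biquadratic a b c d e f g h i = biquadratic a' b' c' d' e' f' g' h' i' \<longleftrightarrow>
     a = a' \<and> b = b' \<and> c = c' \<and> d = d' \<and> e = e' \<and> f = f' \<and> g = g' \<and> h = h' \<and> i = i'"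
  by (auto simp: biquadratic_def)

definition separate_family :: "'a::comm_ring_1 poly poly set" where
  "separate_family = {biquadratic 0 0 0 0 s20 s02 s10 s01 s00 | s20 s02 s10 s01 s00.
     s01 ^ 3 + s02 ^ 3 = 1 \<and> s10 ^ 3 + s20 ^ 3 = 1}"

definition mixed_family :: "'a::comm_ring_1 poly poly set" where
  "mixed_family =
     {biquadratic s22 s21 s12 (s12 * s21 * s22 ^ 2) s20 s02
        ((s20 * s22 + s21 ^ 2) * s12 * s22) ((s02 * s22 + s12 ^ 2) * s21 * s22) s00
      | s22 s21 s12 s20 s02 s00.
        s22 ^ 3 = 1 \<and> s21 ^ 3 = 1 \<and> s12 ^ 3 = 1 \<and>
        s20 * (s20 * s22 + s21 ^ 2) = 0 \<and> s02 * (s02 * s22 + s12 ^ 2) = 0}"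

lemma separate_polynomial_eq:
  "Const s20 * X ^ 2 + Const s02 * Y ^ 2 + Const s10 * X + Const s01 * Y + Const s00 =
     biquadratic 0 0 0 0 s20 s02 s10 s01 s00"
  by (simp add: biquadratic_def Const_def X_def Y_def power2_eq_square)

lemma mixed_polynomial_eq:
  "(Const s22 * X * Y + Const s21 * X + Const s12 * Y + Const s11) * X * Y
     + Const s20 * X ^ 2 + Const s02 * Y ^ 2 + Const s10 * X + Const s01 * Y + Const s00 =
     biquadratic s22 s21 s12 s11 s20 s02 s10 s01 s00"
  by (simp add: biquadratic_def Const_def X_def Y_def power2_eq_square)

section \<open>Total degrees\<close>

lemma coeff_biquadratic_eq_0:
  "2 < i \<or> 2 < j \<Longrightarrow> coeff (coeff (biquadratic s22 s21 s12 s11 s20 s02 s10 s01 s00) j) i = 0"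
  by (auto simp: biquadratic_def coeff_pCons split: nat.splits)

lemma total_degree_eqI:
  assumes "coeff (coeff f j) i \<noteq> 0" "i + j = d"
    and "\<And>i j. coeff (coeff f j) i \<noteq> 0 \<Longrightarrow> i + j \<le> d"
  shows "total_degree f = d"
proof -
  have "f \<noteq> 0" using assms(1) by auto
  moreover have "Max {i + j | i j. coeff (coeff f j) i \<noteq> 0} = d"
  proof (rule Max_eqI)
    show "finite {i + j | i j. coeff (coeff f j) i \<noteq> 0}"
      by (rule finite_subset[of _ "{..d}"]) (auto simp: assms(3))
  qed (use assms in auto)
  ultimately show ?thesis by (simp add: total_degree_def)
qed

lemma total_degree_biquadratic_4:
  assumes "s22 \<noteq> 0"
  shows "total_degree (biquadratic s22 s21 s12 s11 s20 s02 s10 s01 s00) = 4"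
proof (rule total_degree_eqI[where i = 2 and j = 2])
  fix i j
  assume "coeff (coeff (biquadratic s22 s21 s12 s11 s20 s02 s10 s01 s00) j) i \<noteq> 0"
  then have "\<not> (2 < i \<or> 2 < j)" using coeff_biquadratic_eq_0 by blast
  then show "i + j \<le> 4" by auto
qed (use assms in \<open>auto simp: biquadratic_def\<close>)

lemma total_degree_diagonal:
  assumes "s10 \<noteq> 0 \<or> s20 \<noteq> 0"
  shows "total_degree (biquadratic 0 0 0 0 s20 s02 s10 s01 s00) \<in> {1, 2}"
proof -
  let ?f = "biquadratic 0 0 0 0 s20 s02 s10 s01 s00"
  \<comment> \<open>The bound is attained in both cases: at x or, if a square term survives, at x^2
    or y^2. Only in the first case is the hypothesis needed, to make \<open>s10\<close>
    nonzero.\<close>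
  have c: "i + j \<le> (if s20 = 0 \<and> s02 = 0 then 1 else 2)" if "coeff (coeff ?f j) i \<noteq> 0" for i j
    using that
    by (auto simp: biquadratic_def coeff_pCons split: nat.splits if_splits)
  show ?thesis
  proof (cases "s20 = 0 \<and> s02 = 0")
    case True
    then have "total_degree ?f = 1"
      using assms c by (intro total_degree_eqI[where i = 1 and j = 0]) (auto simp: biquadratic_def)
    then show ?thesis by simp
  next
    case False
    have "total_degree ?f = 2"
    proof (cases "s20 = 0")
      case True
      with False c show ?thesis
        by (intro total_degree_eqI[where i = 0 and j = 2]) (auto simp: biquadratic_def)
    next
      case s: False
      with False c show ?thesis
        by (intro total_degree_eqI[where i = 2 and j = 0]) (auto simp: biquadratic_def)
    qed
    then show ?thesis by simp
  qed
qed

section \<open>Substitution into bivariate polynomials, and general facts on finite fields\<close>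

lemma coeff_subst_y: "coeff (subst_y f a) i = poly (map_poly (\<lambda>p. coeff p i) f) a"
proof (induction f)
  case 0
  show ?case by (simp add: subst_y_def)
next
  case (pCons p f)
  then show ?case by (simp add: subst_y_def map_poly_pCons)
qed

lemma coeff_subst_x: "coeff (subst_x f a) j = poly (coeff f j) a"
  by (simp add: subst_x_def coeff_map_poly)

text \<open>Beyond \<open>degree f\<close> the coefficients are zero and so have degree 0; this is
  where \<open>0 < n\<close> enters.\<close>

lemma degree_x_less_iff:
  "0 < n \<Longrightarrow> degree_x f < n \<longleftrightarrow> (\<forall>j. degree (coeff f j) < n)"
proof -
  assume n: "0 < n"
  have "degree_x f < n \<longleftrightarrow> (\<forall>j\<le>degree f. degree (coeff f j) < n)"
    by (auto simp: degree_x_def)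
  also have "\<dots> \<longleftrightarrow> (\<forall>j. degree (coeff f j) < n)"
    using n by (metis coeff_eq_0 degree_0 not_le)
  finally show ?thesis .
qed

lemma poly_eq_0_if_vanishing:
  fixes p :: "'a::{field, finite} poly"
  assumes "degree p < CARD('a)" "\<And>a. poly p a = 0"
  shows "p = 0"
proof (rule ccontr)
  assume "p \<noteq> 0"
  then have "card {x. poly p x = 0} \<le> degree p" by (rule card_poly_roots_bound)
  with assms show False by simp
qed

text \<open>Multiplication by \<open>a\<close> permutes the nonzero elements, so their product is
  unchanged when each factor is multiplied by \<open>a\<close>; cancel that product.\<close>

lemma finite_field_power_card_minus_1:
  fixes a :: "'a::{field, finite}"
  assumes "a \<noteq> 0"
  shows "a ^ (CARD('a) - 1) = 1"
proof -
  let ?P = "\<Prod>x\<in>UNIV - {0::'a}. x"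
  have "bij_betw ((*) a) (UNIV - {0}) (UNIV - {0})"
    by (rule bij_betw_byWitness[where f' = "\<lambda>x. x / a"]) (use assms in auto)
  then have "?P = (\<Prod>x\<in>UNIV - {0}. a * x)"
    by (rule prod.reindex_bij_betw[symmetric])
  also have "\<dots> = a ^ (CARD('a) - 1) * ?P"
    by (simp add: prod.distrib card_Diff_subset)
  finally have "?P = a ^ (CARD('a) - 1) * ?P" .
  moreover have "?P \<noteq> 0" by simp
  ultimately show ?thesis by simp
qed

section \<open>Arithmetic in the field with four elements\<close>

context
  assumes card4: "CARD('a::{field, finite}) = 4"
begin

lemma cube_eq_1 [simp]: "x \<noteq> 0 \<Longrightarrow> (x::'a) ^ 3 = 1"
  using finite_field_power_card_minus_1[of x] by (simp add: card4)

lemma cube_eq_1_iff: "(x::'a) ^ 3 = 1 \<longleftrightarrow> x \<noteq> 0"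
  by auto

lemma power4 [simp]: "(x::'a) ^ 4 = x"
  using cube_eq_1[of x] by (cases "x = 0") (simp_all add: numeral_eq_Suc)

text \<open>The power (-1)^4 is 1 because the exponent is even, and -1 because x^4 = x.\<close>

lemma char_2: "(2::'a) = 0"
proof -
  have "(1::'a) = (- 1) ^ 4" by (simp del: power4)
  also have "\<dots> = - 1" by (rule power4)
  finally show ?thesis by (metis add.right_inverse one_add_one)
qed

text \<open>
  The algebra method computes over the rationals, so it must be given \<open>2 * x = 0\<close> for the
  particular terms \<open>x\<close> that have to cancel, rather than \<open>2 = 0\<close>.
\<close>

lemma double_eq_0: "2 * (x::'a) = 0"
  by (simp add: char_2)

lemma add_self: "(x::'a) + x = 0"
  by (metis mult_2 double_eq_0)

lemma uminus_char_2: "- (x::'a) = x"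
  using add_self[of x] by (simp add: eq_neg_iff_add_eq_0[symmetric])

lemma add_eq_0_iff_char_2: "(x::'a) + y = 0 \<longleftrightarrow> x = y"
  by (metis add_eq_0_iff uminus_char_2)

text \<open>Every cube is 0 or 1, and 1 + 1 = 0. Thus the cubic conditions of the first family
  express that exactly one of two coefficients is nonzero.\<close>

lemma sum_cubes_eq_1_iff: "(x::'a) ^ 3 + y ^ 3 = 1 \<longleftrightarrow> x * y = 0 \<and> (x \<noteq> 0 \<or> y \<noteq> 0)"
  by (cases "x = 0"; cases "y = 0") (auto simp: char_2)

lemma square_surj: "\<exists>y. y ^ 2 = (x::'a)"
proof
  have "(x ^ 2) ^ 2 = x ^ 4" by (simp only: power_mult[symmetric]) simp
  then show "(x ^ 2) ^ 2 = x" by (simp only: power4)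
qed

text \<open>Any element other than 0 and 1 is a root of w^3 - 1 but not of its factor w - 1, hence a
  root of the cofactor w^2 + w + 1.\<close>

lemma exists_primitive_element: "\<exists>w::'a. w ^ 2 = w + 1"
proof -
  have "card {0, 1::'a} \<noteq> CARD('a)" using card4 by simp
  then have "{0, 1::'a} \<noteq> UNIV" by (rule contrapos_nn) simp
  then obtain w :: 'a where w: "w \<noteq> 0" "w \<noteq> 1" by blast
  have "(w - 1) * (w ^ 2 + w + 1) = w ^ 3 - 1"
    by (simp add: algebra_simps power2_eq_square power3_eq_cube)
  with w have "w ^ 2 + (w + 1) = 0" by (simp add: add.assoc)
  then show ?thesis unfolding add_eq_0_iff_char_2 by blast
qed

section \<open>Permutation polynomials of degree at most 3\<close>

lemma permutation_poly_pCons4: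
  "permutation_poly [:a, b, c, d::'a:] \<longleftrightarrow> d = 0 \<and> b * c = 0 \<and> (b \<noteq> 0 \<or> c \<noteq> 0)"
proof
  assume "permutation_poly [:a, b, c, d:]"
  then have inj: "inj (poly [:a, b, c, d:])" by (simp add: permutation_poly_def bij_def)
  \<comment> \<open>Compare the values at z and 0: their difference is z times this
    quadratic.\<close>
  have 1: "d * z ^ 2 + c * z + b \<noteq> 0" if "z \<noteq> 0" for z
  proof
    assume "d * z ^ 2 + c * z + b = 0"
    then have "poly [:a, b, c, d:] z = poly [:a, b, c, d:] 0"
      by simp algebra
    with inj that show False by (metis injD)
  qed
  \<comment> \<open>Compare the values at z w and z (w + 1) = z w^2. Both arguments have the same
    cube, so \<open>d\<close> drops out, and since they add up to z the difference is z (c z +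
    b).\<close>
  have 2: "c * z + b \<noteq> 0" if "z \<noteq> 0" for z
  proof
    assume "c * z + b = 0"
    moreover obtain w :: 'a where "w ^ 2 = w + 1" using exists_primitive_element by blast
    ultimately have "poly [:a, b, c, d:] (z * w) = poly [:a, b, c, d:] (z * (w + 1))"
      using double_eq_0[of z] by (simp only: poly_pCons poly_0) algebra
    with inj have "z * w = z * (w + 1)" by (metis injD)
    with that show False by simp
  qed
  have bc: "b * c = 0 \<and> (b \<noteq> 0 \<or> c \<noteq> 0)"
    using 2[of 1] 2[of "b / c"] by (auto simp: char_2)
  moreover have "d = 0"
  proof (rule ccontr)
    assume d: "d \<noteq> 0"
    obtain z where z: "z ^ 2 = b / d" using square_surj by blast
    show False
      \<comment> \<open>One of \<open>b\<close>, \<open>c\<close> is zero. If \<open>b = 0\<close>,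
        then c/d is a nonzero root of the quadratic in \<open>1\<close>; if \<open>c = 0\<close>,
        the square root z of b/d is one.\<close>
      using bc d 1[of z] 1[of "c / d"] z by (cases "b = 0"; cases "z = 0") (auto simp: power2_eq_square char_2)
  qed
  ultimately show "d = 0 \<and> b * c = 0 \<and> (b \<noteq> 0 \<or> c \<noteq> 0)" by blast
next
  assume *: "d = 0 \<and> b * c = 0 \<and> (b \<noteq> 0 \<or> c \<noteq> 0)"
  have "inj (poly [:a, b, c, d:])"
  proof (rule injI)
    fix x y assume "poly [:a, b, c, d:] x = poly [:a, b, c, d:] y"
    \<comment> \<open>Squaring is additive in characteristic 2, so the polynomial without its
      constant term is additive and only its kernel matters.\<close>
    then have "b * (x + y) + c * (x + y) ^ 2 = 0"
      using * double_eq_0[of "b * y + c * x * y + c * y ^ 2"]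
      by (simp only: poly_pCons poly_0) algebra
    with * have "x + y = 0" by auto
    then show "x = y" by (simp add: add_eq_0_iff_char_2)
  qed
  then show "permutation_poly [:a, b, c, d:]"
    unfolding permutation_poly_def bij_def
    using finite_UNIV_inj_surj[OF finite] by blast
qed

lemma permutation_poly_pCons3:
  "permutation_poly [:a, b, c::'a:] \<longleftrightarrow> b * c = 0 \<and> (b \<noteq> 0 \<or> c \<noteq> 0)"
  using permutation_poly_pCons4[of a b c 0] by simp

lemma permutation_poly_imp_coeff_3_eq_0:
  fixes p :: "'a poly"
  assumes "permutation_poly p" "degree p < 4"
  shows "coeff p 3 = 0"
  using assms permutation_poly_pCons4 poly_eq_pCons4I by metis

section \<open>Local permutation polynomials in terms of their coefficients\<close>

lemma local_perm_polys_imp_biquadratic: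
  fixes f :: "'a poly poly"
  assumes "f \<in> local_perm_polys"
  obtains s22 s21 s12 s11 s20 s02 s10 s01 s00
    where "f = biquadratic s22 s21 s12 s11 s20 s02 s10 s01 s00"
proof -
  from assms have dx: "degree (coeff f j) < 4" and dy: "degree f < 4"
    and perm: "permutation_poly (subst_y f a)" "permutation_poly (subst_x f a)" for j a
    by (auto simp: local_perm_polys_def degree_y_def card4 degree_x_less_iff)
  have coeff_x: "coeff (coeff f j) i = 0" if "3 \<le> i" for i j
  proof (cases "i = 3")
    case True
    \<comment> \<open>The coefficient of x^3 in \<open>f\<close> is a polynomial in y of degree less
      than 4. Its value at each \<open>a\<close> is the cubic coefficient of the permutation
      polynomial f(x,a), hence 0.\<close>
    have "map_poly (\<lambda>p. coeff p 3) f = 0"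
    proof (rule poly_eq_0_if_vanishing)
      show "degree (map_poly (\<lambda>p. coeff p 3) f) < CARD('a)"
        using dy map_poly_degree_leq[of "\<lambda>p. coeff p 3" f] by (simp add: card4)
      show "poly (map_poly (\<lambda>p. coeff p 3) f) a = 0" for a
      proof -
        \<comment> \<open>This bounds the degree of f(x,a) by 3, as the criterion for permutation
          polynomials requires.\<close>
        have "coeff (subst_y f a) i = 0" if "3 < i" for i
        proof -
          have "degree (coeff f j) < i" for j
            using dx[of j] that by simp
          then have "map_poly (\<lambda>p. coeff p i) f = 0"
            by (intro poly_eqI) (simp add: coeff_map_poly coeff_eq_0)
          then show ?thesis by (simp add: coeff_subst_y)
        qed
        then have "degree (subst_y f a) \<le> 3" by (intro degree_le) auto
        then have "coeff (subst_y f a) 3 = 0"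
          using perm permutation_poly_imp_coeff_3_eq_0 by simp
        then show ?thesis by (simp add: coeff_subst_y)
      qed
    qed
    then have "coeff (map_poly (\<lambda>p. coeff p 3) f) j = 0" by simp
    then show ?thesis using True by (simp add: coeff_map_poly)
  next
    case False
    with that dx[of j] show ?thesis by (intro coeff_eq_0) simp
  qed
  have coeff_y: "coeff f j = 0" if "3 \<le> j" for j
  proof (cases "j = 3")
    case True
    have "coeff f 3 = 0"
    proof (rule poly_eq_0_if_vanishing)
      show "degree (coeff f 3) < CARD('a)" using dx by (simp add: card4)
      show "poly (coeff f 3) a = 0" for a
      proof -
        have "degree (subst_x f a) < 4"
          using dy map_poly_degree_leq[of "\<lambda>p. poly p a" f] by (simp add: subst_x_def)
        then show ?thesis
          using perm(2)[of a] permutation_poly_imp_coeff_3_eq_0 coeff_subst_x by metis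
      qed
    qed
    then show ?thesis using True by simp
  next
    case False
    with that dy show ?thesis by (intro coeff_eq_0) simp
  qed
  have "f = [:coeff f 0, coeff f 1, coeff f 2:]"
    using coeff_y by (rule poly_eq_pCons3I)
  then obtain p q r where f: "f = [:p, q, r:]"
    and "p = coeff f 0" "q = coeff f 1" "r = coeff f 2" by blast
  then have "p = [:coeff p 0, coeff p 1, coeff p 2:]" "q = [:coeff q 0, coeff q 1, coeff q 2:]"
    "r = [:coeff r 0, coeff r 1, coeff r 2:]"
    using coeff_x by (metis poly_eq_pCons3I)+
  with f show thesis using that unfolding biquadratic_def by metis
qed

text \<open>Fixing one variable leaves a quadratic in the other, whose coefficients are quadratics
  in the fixed value; \<open>permutation_poly_pCons3\<close> applies to each of them.\<close>

lemma local_perm_polys_biquadratic_iff: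
  "biquadratic s22 s21 s12 s11 s20 s02 s10 s01 (s00::'a) \<in> local_perm_polys \<longleftrightarrow>
     (\<forall>y. (s10 + s11 * y + s12 * y ^ 2) * (s20 + s21 * y + s22 * y ^ 2) = 0 \<and>
          (s10 + s11 * y + s12 * y ^ 2 \<noteq> 0 \<or> s20 + s21 * y + s22 * y ^ 2 \<noteq> 0)) \<and>
     (\<forall>x. (s01 + s11 * x + s21 * x ^ 2) * (s02 + s12 * x + s22 * x ^ 2) = 0 \<and>
          (s01 + s11 * x + s21 * x ^ 2 \<noteq> 0 \<or> s02 + s12 * x + s22 * x ^ 2 \<noteq> 0))"
proof -
  let ?f = "biquadratic s22 s21 s12 s11 s20 s02 s10 s01 s00"
  have "degree_y ?f < 4"
    unfolding degree_y_def biquadratic_def using degree_pCons_le by (simp add: less_Suc_eq_le numeral_eq_Suc)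
  moreover have "degree (coeff ?f j) \<le> 2" for j
    by (rule degree_le) (simp add: coeff_biquadratic_eq_0)
  then have "degree (coeff ?f j) < 4" for j
    by (rule le_less_trans) simp
  then have "degree_x ?f < 4"
    by (simp add: degree_x_less_iff)
  moreover have "subst_y ?f y = [:s00 + s01 * y + s02 * y ^ 2,
      s10 + s11 * y + s12 * y ^ 2, s20 + s21 * y + s22 * y ^ 2:]" for y
    by (simp add: subst_y_def biquadratic_def algebra_simps power2_eq_square)
  moreover have "subst_x ?f x = [:s00 + s10 * x + s20 * x ^ 2,
      s01 + s11 * x + s21 * x ^ 2, s02 + s12 * x + s22 * x ^ 2:]" for x
    by (simp add: subst_x_def biquadratic_def map_poly_pCons algebra_simps power2_eq_square)
  ultimately show ?thesis
    by (auto simp: local_perm_polys_def card4 permutation_poly_pCons3)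
qed

lemma quadratic_product_vanishes_iff:
  fixes a0 a1 a2 b0 b1 b2 :: 'a
  shows "(\<forall>y. (b0 + b1 * y + b2 * y ^ 2) * (a0 + a1 * y + a2 * y ^ 2) = 0) \<longleftrightarrow>
    b0 * a0 = 0 \<and> b0 * a1 + b1 * a0 + b2 * a2 = 0 \<and> b0 * a2 + b1 * a1 + b2 * a0 = 0 \<and>
    b1 * a2 + b2 * a1 = 0"
    (is "?L \<longleftrightarrow> ?R")
proof -
  let ?p = "[:b0 * a0, b0 * a1 + b1 * a0 + b2 * a2, b0 * a2 + b1 * a1 + b2 * a0, b1 * a2 + b2 * a1:]"
  have eq: "(b0 + b1 * y + b2 * y ^ 2) * (a0 + a1 * y + a2 * y ^ 2) = poly ?p y" for y
  proof -
    \<comment> \<open>Since y^4 = y on the field, the top term \<open>b2 * a2\<close> joins the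
      coefficient of y. The remainder has degree less than 4, so it vanishes everywhere only if its
      coefficients do.\<close>
    have "(b0 + b1 * y + b2 * y ^ 2) * (a0 + a1 * y + a2 * y ^ 2) = poly ?p y + b2 * a2 * (y ^ 4 - y)"
      by (simp only: poly_pCons poly_0) algebra
    then show ?thesis by simp
  qed
  have "degree ?p < CARD('a)"
    by (simp add: card4)
  then have "(\<forall>y. poly ?p y = 0) \<longleftrightarrow> ?p = 0"
    using poly_eq_0_if_vanishing[of ?p] by (metis poly_0)
  also have "\<dots> \<longleftrightarrow> ?R" by simp
  finally show ?thesis unfolding eq .
qed

text \<open>Used for contradictions: at the root, the companion quadratic in
  \<open>local_perm_polys_biquadratic_iff\<close> must be nonzero.\<close>

lemma quadratic_has_root:
  fixes b0 b1 b2 :: 'a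
  assumes "b1 * b2 = 0" "b1 \<noteq> 0 \<or> b2 \<noteq> 0"
  obtains y where "b0 + b1 * y + b2 * y ^ 2 = 0"
proof (cases "b1 = 0")
  case True
  obtain y where "y ^ 2 = b0 / b2" using square_surj by blast
  with True assms that[of y] show ?thesis by (simp add: add_self)
next
  case False
  with assms that[of "b0 / b1"] show ?thesis by (simp add: add_self)
qed

text \<open>The idea is that \<open>q = c a^2 (p + b^2 a^2)\<close>, so \<open>p\<close> and \<open>q\<close> cannot vanish together.\<close>

lemma mixed_quadratics:
  fixes a b c e y :: 'a
  assumes a: "a ^ 3 = 1" and b: "b ^ 3 = 1" and c: "c ^ 3 = 1" and e: "e * (e * a + b ^ 2) = 0"
  defines "p \<equiv> \<lambda>y. e + b * y + a * y ^ 2"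
    and "q \<equiv> \<lambda>y. (e * a + b ^ 2) * c * a + c * b * a ^ 2 * y + c * y ^ 2"
  shows "q y * p y = 0" and "q y \<noteq> 0 \<or> p y \<noteq> 0"
proof -
  \<comment> \<open>These are the four equations of \<open>quadratic_product_vanishes_iff\<close>,
    with q as the first factor and p as the second.\<close>
  have "(e * a + b ^ 2) * c * a * e = 0"
    using e by auto
  moreover have "(e * a + b ^ 2) * c * a * b + c * b * a ^ 2 * e + c * a = 0"
    using b double_eq_0[of "c * a"] double_eq_0[of "c * b * e * a ^ 2"] by algebra
  moreover have "(e * a + b ^ 2) * c * a * a + c * b * a ^ 2 * b + c * e = 0"
    using a double_eq_0[of "c * e"] double_eq_0[of "c * b ^ 2 * a ^ 2"] by algebra
  moreover have "c * b * a ^ 2 * a + c * b = 0"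
    using a double_eq_0[of "c * b"] by algebra
  ultimately show "q y * p y = 0"
    unfolding p_def q_def using quadratic_product_vanishes_iff by blast
  have "q y = c * a ^ 2 * (p y + b ^ 2 * a ^ 2)"
    unfolding p_def q_def using a by algebra
  moreover have "a \<noteq> 0" "b \<noteq> 0" "c \<noteq> 0"
    using a b c by auto
  ultimately show "q y \<noteq> 0 \<or> p y \<noteq> 0" by auto
qed

lemma local_perm_polys_biquadratic_cases:
  fixes s22 s21 s12 s11 s20 s02 s10 s01 s00 :: 'a
  shows "biquadratic s22 s21 s12 s11 s20 s02 s10 s01 s00 \<in> local_perm_polys \<longleftrightarrow>
     s22 = 0 \<and> s21 = 0 \<and> s12 = 0 \<and> s11 = 0 \<and> s01 ^ 3 + s02 ^ 3 = 1 \<and> s10 ^ 3 + s20 ^ 3 = 1 \<or>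
     s22 ^ 3 = 1 \<and> s21 ^ 3 = 1 \<and> s12 ^ 3 = 1 \<and>
     s20 * (s20 * s22 + s21 ^ 2) = 0 \<and> s02 * (s02 * s22 + s12 ^ 2) = 0 \<and>
     s11 = s12 * s21 * s22 ^ 2 \<and> s10 = (s20 * s22 + s21 ^ 2) * s12 * s22 \<and>
     s01 = (s02 * s22 + s12 ^ 2) * s21 * s22"
    (is "?f \<in> _ \<longleftrightarrow> ?D \<or> ?E")
proof
  assume "?f \<in> local_perm_polys"
  then have
    y0: "\<forall>y. (s10 + s11 * y + s12 * y ^ 2) * (s20 + s21 * y + s22 * y ^ 2) = 0" and
    y1: "\<And>y. s10 + s11 * y + s12 * y ^ 2 \<noteq> 0 \<or> s20 + s21 * y + s22 * y ^ 2 \<noteq> 0" and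
    x0: "\<forall>x. (s01 + s11 * x + s21 * x ^ 2) * (s02 + s12 * x + s22 * x ^ 2) = 0" and
    x1: "\<And>x. s01 + s11 * x + s21 * x ^ 2 \<noteq> 0 \<or> s02 + s12 * x + s22 * x ^ 2 \<noteq> 0"
    unfolding local_perm_polys_biquadratic_iff by blast+
  note y = y0[unfolded quadratic_product_vanishes_iff]
  note x = x0[unfolded quadratic_product_vanishes_iff]
  show "?D \<or> ?E"
  proof (cases "s22 = 0")
    case True
    have "s12 = 0 \<and> s21 = 0 \<and> s11 = 0"
    proof (cases "s21 = 0")
      case s21: True
      have "s11 * s12 = 0" using x True s21 by simp
      \<comment> \<open>At a root of the coefficient of x, the coefficient of x^2, now the constant
        \<open>s20\<close>, is nonzero. But the equations \<open>y\<close> reduce to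
        \<open>s11 * s20 = 0\<close> and \<open>s12 * s20 = 0\<close>.\<close>
      moreover have False if "s11 \<noteq> 0 \<or> s12 \<noteq> 0" "s11 * s12 = 0"
        using quadratic_has_root[OF that(2,1), of s10] y1 y True s21 that by auto
      ultimately show ?thesis using s21 by blast
    next
      case False
      then have s12: "s12 = 0" using y True by simp
      have "s11 * s21 = 0" using y True s12 by simp
      \<comment> \<open>The same with x and y exchanged: \<open>s02\<close> is nonzero at a root,
        while \<open>x\<close> gives \<open>s21 * s02 = 0\<close>.\<close>
      moreover have False if "s11 \<noteq> 0 \<or> s21 \<noteq> 0" "s11 * s21 = 0"
        using quadratic_has_root[OF that(2,1), of s01] x1 x True s12 that by auto
      ultimately show ?thesis using s12 by blast
    qed
    then show ?thesis
      using True y x y1[of 0] x1[of 0] by (auto simp: sum_cubes_eq_1_iff)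
  next
    case False
    then have c: "s22 ^ 3 = 1" by simp
    \<comment> \<open>The inverse of \<open>s22\<close> is its square, so the equations in which
      \<open>s22\<close> multiplies \<open>s11\<close>, \<open>s10\<close> and \<open>s01\<close>
      can be solved for these.\<close>
    have s11: "s11 = s12 * s21 * s22 ^ 2"
      using c y double_eq_0[of "s12 * s21 * s22 ^ 2"] by algebra
    have s10: "s10 = (s20 * s22 + s21 ^ 2) * s12 * s22"
      using c y[THEN conjunct2, THEN conjunct2, THEN conjunct1] s11
      double_eq_0[of "(s20 * s22 + s21 ^ 2) * s12 * s22"] by algebra
    have s01: "s01 = (s02 * s22 + s12 ^ 2) * s21 * s22"
      using c x[THEN conjunct2, THEN conjunct2, THEN conjunct1] s11
      double_eq_0[of "(s02 * s22 + s12 ^ 2) * s21 * s22"] by algebra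
    \<comment> \<open>Substitute \<open>s11\<close> and \<open>s10\<close> into the equation for the
      coefficient of y; the terms containing \<open>s20\<close> cancel in characteristic 2.\<close>
    have "s12 * s22 * (s21 ^ 3 + 1) = 0"
      using c y s11 s10 double_eq_0[of "s20 * s21 * s12 * s22 ^ 2"] by algebra
    then have s12: "s12 = 0 \<or> s21 ^ 3 = 1"
      using False by (auto simp: add_eq_0_iff_char_2)
    have "s21 * s22 * (s12 ^ 3 + 1) = 0"
      using c x s11 s01 double_eq_0[of "s02 * s21 * s12 * s22 ^ 2"] by algebra
    then have s21: "s21 = 0 \<or> s12 ^ 3 = 1"
      using False by (auto simp: add_eq_0_iff_char_2)
    have "s12 \<noteq> 0 \<or> s21 \<noteq> 0"
    proof (rule ccontr)
      \<comment> \<open>Then \<open>s11\<close> and \<open>s10\<close> vanish too, so the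
        coefficient of x is identically zero, while that of x^2 still has a root.\<close>
      assume *: "\<not> (s12 \<noteq> 0 \<or> s21 \<noteq> 0)"
      obtain y where "s20 + 0 * y + s22 * y ^ 2 = 0"
        using quadratic_has_root[of 0 s22 s20] False by auto
      with * y1[of y] s11 s10 show False by simp
    qed
    with s12 s21 have n: "s12 ^ 3 = 1" "s21 ^ 3 = 1" by auto
    have "s20 * (s20 * s22 + s21 ^ 2) = 0" "s02 * (s02 * s22 + s12 ^ 2) = 0"
      using x y s10 s01 c n by (auto simp: cube_eq_1_iff)
    with c n s11 s10 s01 show ?thesis by blast
  qed
next
  assume "?D \<or> ?E"
  then show "?f \<in> local_perm_polys"
  proof
    assume ?D
    then show ?thesis
      unfolding local_perm_polys_biquadratic_iff by (auto simp: sum_cubes_eq_1_iff)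
  next
    assume E: ?E
    \<comment> \<open>The second instance is the first with x and y exchanged; the two differ in the
      order of the factors of \<open>s11\<close>.\<close>
    note y = mixed_quadratics[of s22 s21 s12 s20] and x = mixed_quadratics[of s22 s12 s21 s02]
    show ?thesis
      using E y x unfolding local_perm_polys_biquadratic_iff
      by (simp add: mult.commute[of s12 s21])
  qed
qed

section \<open>Decomposition by total degree, and separation of variables\<close>

lemma local_perm_polys_eq:
  "(local_perm_polys :: 'a poly poly set) = separate_family \<union> mixed_family"
proof (intro set_eqI iffI)
  fix f :: "'a poly poly"
  assume f: "f \<in> local_perm_polys"
  then obtain s22 s21 s12 s11 s20 s02 s10 s01 s00
    where "f = biquadratic s22 s21 s12 s11 s20 s02 s10 s01 s00"
    by (rule local_perm_polys_imp_biquadratic)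
  with f show "f \<in> separate_family \<union> mixed_family"
    unfolding separate_family_def mixed_family_def
    by (simp only: local_perm_polys_biquadratic_cases) blast
next
  fix f :: "'a poly poly"
  assume "f \<in> separate_family \<union> mixed_family"
  then show "f \<in> local_perm_polys"
    unfolding separate_family_def mixed_family_def
    by (auto simp: local_perm_polys_biquadratic_cases)
qed

lemma total_degree_separate_family:
  assumes "f \<in> separate_family"
  shows "total_degree (f :: 'a poly poly) \<in> {1, 2}"
proof -
  obtain s20 s02 s10 s01 s00 where f: "f = biquadratic 0 0 0 0 s20 s02 s10 s01 s00"
    and "s10 ^ 3 + s20 ^ 3 = 1"
    using assms unfolding separate_family_def by blast
  then have "s10 \<noteq> 0 \<or> s20 \<noteq> 0" by (simp add: sum_cubes_eq_1_iff)
  then show ?thesis unfolding f by (rule total_degree_diagonal)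
qed

lemma total_degree_mixed_family:
  assumes "f \<in> mixed_family"
  shows "total_degree (f :: 'a poly poly) = 4"
  using assms unfolding mixed_family_def by (auto simp: cube_eq_1_iff intro: total_degree_biquadratic_4)

lemma local_perm_polys_deg_1_2:
  "local_perm_polys_deg 1 \<union> local_perm_polys_deg 2 = (separate_family :: 'a poly poly set)"
  unfolding local_perm_polys_deg_def local_perm_polys_eq
  using total_degree_separate_family total_degree_mixed_family by fastforce

lemma local_perm_polys_deg_4:
  "local_perm_polys_deg 4 = (mixed_family :: 'a poly poly set)"
  unfolding local_perm_polys_deg_def local_perm_polys_eq
  using total_degree_separate_family total_degree_mixed_family by fastforce

lemma separate_variables_separate_family:
  assumes "f \<in> separate_family"
  shows "separate_variables (f :: 'a poly poly)"
proof -
  obtain s20 s02 s10 s01 s00 where f: "f = biquadratic 0 0 0 0 s20 s02 s10 s01 s00"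
    and s: "s10 ^ 3 + s20 ^ 3 = 1" "s01 ^ 3 + s02 ^ 3 = 1"
    using assms unfolding separate_family_def by blast
  \<comment> \<open>The constant term may go to either summand; here h1 takes it.\<close>
  have "f = [:[:s00, s10, s20:]:] + map_poly (\<lambda>c. [:c:]) [:0, s01, s02:]"
    unfolding f by (simp add: biquadratic_def map_poly_pCons)
  moreover have "permutation_poly [:s00, s10, s20:]" "permutation_poly [:0, s01, s02:]"
    using s by (simp_all add: permutation_poly_pCons3 sum_cubes_eq_1_iff)
  moreover have "degree [:s00, s10, s20:] < CARD('a)" "degree [:0, s01, s02:] < CARD('a)"
    by (simp_all add: card4)
  ultimately show ?thesis unfolding separate_variables_def by blast
qed

lemma not_separate_variables_mixed_family:
  assumes "f \<in> mixed_family"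
  shows "\<not> separate_variables (f :: 'a poly poly)"
proof
  assume "separate_variables f"
  \<comment> \<open>A sum h1(x) + h2(y) contains no mixed monomial, whereas the mixed family has
    \<open>s22\<close> nonzero.\<close>
  then have "coeff (coeff f 2) 2 = 0"
    by (auto simp: separate_variables_def coeff_map_poly numeral_2_eq_2)
  with assms show False
    by (auto simp: mixed_family_def biquadratic_def)
qed

section \<open>Counting the two families\<close>

lemma card_nonzero: "card (UNIV - {0 :: 'a}) = 3"
  by (simp add: card_Diff_subset card4)

lemma card_sum_cubes_eq_1: "card {(x, y). (x::'a) ^ 3 + y ^ 3 = 1} = 6"
proof -
  have "{(x, y). (x::'a) ^ 3 + y ^ 3 = 1} = (UNIV - {0}) \<times> {0} \<union> {0} \<times> (UNIV - {0})"
    by (auto simp: sum_cubes_eq_1_iff)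
  then show ?thesis
    by (simp add: card_Un_disjoint card_cartesian_product card_nonzero Int_Un_distrib disjoint_iff)
qed

text \<open>Six choices for each pair of coefficients in one variable and four for
  \<open>s00\<close>: 6 * 6 * 4.\<close>

lemma card_separate_family: "card (separate_family :: 'a poly poly set) = 144"
proof -
  let ?U = "{(x, y). (x::'a) ^ 3 + y ^ 3 = 1}"
  let ?g = "\<lambda>((s10, s20), (s01, s02), s00). biquadratic 0 0 0 0 s20 s02 s10 s01 (s00 :: 'a)"
  have eq: "separate_family = ?g ` (?U \<times> ?U \<times> UNIV)"
    by (force simp: separate_family_def image_iff)
  have inj: "inj_on ?g (?U \<times> ?U \<times> UNIV)"
    by (auto simp: inj_on_def biquadratic_eq_iff)
  show ?thesis
    unfolding eq card_image[OF inj]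
    by (simp add: card_cartesian_product card_sum_cubes_eq_1 card4)
qed

text \<open>The roots are 0 and b^2/a, which are distinct; 1/a is a^2.\<close>

lemma card_mult_sum_square_eq_0:
  assumes "(a::'a) \<noteq> 0" "b \<noteq> 0"
  shows "card {e. e * (e * a + b ^ 2) = 0} = 2"
proof -
  have "e * a = b ^ 2 \<longleftrightarrow> e = b ^ 2 * a ^ 2" for e
    using cube_eq_1[OF assms(1)] by algebra
  then have "{e. e * (e * a + b ^ 2) = 0} = {0, b ^ 2 * a ^ 2}"
    by (auto simp: add_eq_0_iff_char_2)
  then show ?thesis using assms by simp
qed

text \<open>The coefficients \<open>s11\<close>, \<open>s10\<close>, \<open>s01\<close> are
  determined by the other six. These allow 3 * 3 * 3 choices of nonzero elements, 2 * 2 of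
  \<open>s20\<close> and \<open>s02\<close>, and 4 of \<open>s00\<close>.\<close>

lemma card_mixed_family: "card (mixed_family :: 'a poly poly set) = 432"
proof -
  let ?N = "UNIV - {0::'a}"
  let ?R = "\<lambda>(a::'a) b. {e. e * (e * a + b ^ 2) = 0}"
  let ?S = "SIGMA s22:?N. SIGMA s21:?N. SIGMA s12:?N. ?R s22 s21 \<times> ?R s22 s12 \<times> (UNIV :: 'a set)"
  let ?g = "\<lambda>(s22, s21, s12, s20, s02, s00).
    biquadratic s22 s21 s12 (s12 * s21 * s22 ^ 2) s20 s02
      ((s20 * s22 + s21 ^ 2) * s12 * s22) ((s02 * s22 + s12 ^ 2) * s21 * s22) s00"
  have eq: "mixed_family = ?g ` ?S"
  proof (intro set_eqI iffI)
    fix f :: "'a poly poly"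
    assume "f \<in> mixed_family"
    then obtain s22 s21 s12 s20 s02 s00 where
      f: "f = ?g (s22, s21, s12, s20, s02, s00)" and
      n: "s22 \<noteq> 0" "s21 \<noteq> 0" "s12 \<noteq> 0" and
      s: "s20 * (s20 * s22 + s21 ^ 2) = 0" "s02 * (s02 * s22 + s12 ^ 2) = 0"
      unfolding mixed_family_def cube_eq_1_iff prod.case by blast
    have "(s22, s21, s12, s20, s02, s00) \<in> ?S" using n s by blast
    then show "f \<in> ?g ` ?S" unfolding f by (rule imageI)
  next
    fix f :: "'a poly poly"
    assume "f \<in> ?g ` ?S"
    then obtain s22 s21 s12 s20 s02 s00 where
      f: "f = ?g (s22, s21, s12, s20, s02, s00)" and
      "s22 \<noteq> 0" "s21 \<noteq> 0" "s12 \<noteq> 0"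
      "s20 * (s20 * s22 + s21 ^ 2) = 0" "s02 * (s02 * s22 + s12 ^ 2) = 0"
      by blast
    then show "f \<in> mixed_family"
      unfolding f mixed_family_def cube_eq_1_iff prod.case by blast
  qed
  have inj: "inj_on ?g ?S"
    by (rule inj_onI) (clarsimp simp: biquadratic_eq_iff simp del: mult_eq_0_iff)
  show ?thesis
    unfolding eq card_image[OF inj]
    \<comment> \<open>Without \<open>mult_eq_0_iff\<close> the root sets keep the shape that
      \<open>card_mult_sum_square_eq_0\<close> matches.\<close>
    by (simp add: card_SigmaI card_cartesian_product card_nonzero card4
        card_mult_sum_square_eq_0 del: mult_eq_0_iff)
qed

end

theorem theorem3p1:
  assumes "CARD('a::{field, finite}) = 4"
  shows
    "(local_perm_polys :: 'a poly poly set) =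
       (local_perm_polys_deg 1 \<union> local_perm_polys_deg 2) \<union> local_perm_polys_deg 4 \<and>
     (local_perm_polys_deg 1 \<union> local_perm_polys_deg 2) \<inter> local_perm_polys_deg 4
       = ({} :: 'a poly poly set) \<and>
     local_perm_polys_deg 1 \<inter> local_perm_polys_deg 2 = ({} :: 'a poly poly set) \<and>
     (local_perm_polys_deg 1 \<union> local_perm_polys_deg 2 :: 'a poly poly set) =
       {Const s20 * X^2 + Const s02 * Y^2 + Const s10 * X + Const s01 * Y + Const s00
        | s20 s02 s10 s01 s00. s01^3 + s02^3 = 1 \<and> s10^3 + s20^3 = 1} \<and>
     (local_perm_polys_deg 1 \<union> local_perm_polys_deg 2 :: 'a poly poly set) =
       {f \<in> local_perm_polys. separate_variables f} \<and>
     card (local_perm_polys_deg 1 \<union> local_perm_polys_deg 2 :: 'a poly poly set) = 144 \<and>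
     (local_perm_polys_deg 4 :: 'a poly poly set) =
       {(Const s22 * X * Y + Const s21 * X + Const s12 * Y + Const (s12 * s21 * s22^2)) * X * Y
          + Const s20 * X^2 + Const s02 * Y^2
          + Const ((s20 * s22 + s21^2) * s12 * s22) * X
          + Const ((s02 * s22 + s12^2) * s21 * s22) * Y
          + Const s00
        | s22 s21 s12 s20 s02 s00.
          s22^3 = 1 \<and> s21^3 = 1 \<and> s12^3 = 1 \<and>
          s20 * (s20 * s22 + s21^2) = 0 \<and> s02 * (s02 * s22 + s12^2) = 0} \<and>
     card (local_perm_polys_deg 4 :: 'a poly poly set) = 432"
proof -
  have sep: "(separate_family :: 'a poly poly set) = {f \<in> local_perm_polys. separate_variables f}"
    unfolding local_perm_polys_eq[OF assms]
    using separate_variables_separate_family[OF assms] not_separate_variables_mixed_family[OF assms]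
    by blast
  show ?thesis
    unfolding sep[symmetric] local_perm_polys_deg_1_2[OF assms] local_perm_polys_deg_4[OF assms]
  proof (intro conjI)
    show "separate_family \<inter> mixed_family = ({} :: 'a poly poly set)"
      using total_degree_separate_family[OF assms] total_degree_mixed_family[OF assms] by fastforce
    show "local_perm_polys_deg 1 \<inter> local_perm_polys_deg 2 = ({} :: 'a poly poly set)"
      by (auto simp: local_perm_polys_deg_def)
  \<comment> \<open>Folding turns \<open>biquadratic\<close> in the definitions of the families back
    into the displayed expressions in \<open>X\<close> and \<open>Y\<close>.\<close>
  qed (rule refl local_perm_polys_eq[OF assms] card_separate_family[OF assms]
      card_mixed_family[OF assms] separate_family_def[folded separate_polynomial_eq]
      mixed_family_def[folded mixed_polynomial_eq])+
qed

end
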